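(* Let $1 \le m \le n$. The restriction of the Burnside process on $(C_2^n, S_n)$ to any $m$ of its coordinates is also a Markov chain, and its transition probabilities are exactly those of the Burnside process on $(C_2^m, S_m)$. That is, for every $S \subseteq [n]$ with $|S| = m$, if $(X_t)_{t \ge 0}$ is the Burnside process on $(C_2^n,S_n)$ started from any initial distribution, then $((X_t)_S)_{t \ge 0}$ is a Markov chain whose transition matrix is that of the Burnside process on $(C_2^m, S_m)$ (identifying $C_2^S$ with $C_2^m$), where $x_S$ denotes the restriction of $x$ to the coordinates in $S$.
   Context: $C_2^n = \{0,1\}^n$ is the set of binary $n$-tuples and $[n] = \{1,\dots,n\}$. The symmetric group $S_n$ acts on $C_2^n$ by permuting coordinates. The Burnside process on $(C_2^n, S_n)$ is the Markov chain on $C_2^n$ which from $x$ chooses $s$ uniformly from the stabilizer $G_x = \{s \in S_n : s \text{ fixes } x\}$ and then moves to $y$ chosen uniformly from $\mathfrak{X}_s = \{y \in C_2^n : s \text{ fixes } y\}$; its transition matrix is $$K_n(x,y) = \frac{1}{|G_x|}\sum_{s \in G_x \cap G_y} \frac{1}{|\mathfrak{X}_s|}.$$ *)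

theory Defs
  imports "HOL-Probability.Probability" "HOL-Algebra.Group_Action" "HOL-Algebra.Sym_Groups"
begin

definition cube :: "nat \<Rightarrow> (nat \<Rightarrow> nat) set" where
  "cube n = {1..n} \<rightarrow>\<^sub>E {0, 1}"

(* (s x)_i = x_{s^{-1}(i)}; the restriction to the cube makes each map an element of
   the carrier of BijGroup, as the locale group_action requires. *)
definition coord_action :: "nat \<Rightarrow> (nat \<Rightarrow> nat) \<Rightarrow> (nat \<Rightarrow> nat) \<Rightarrow> (nat \<Rightarrow> nat)" where
  "coord_action n s = (\<lambda>x\<in>cube n. x \<circ> inv' s)"

(* For the action phi of G on E, stabilizer G phi x is the stabilizer of x, and
   invariants E phi s is the set of points of E fixed by s. *)
definition burnside_matrix ::
  "('g, 'z) monoid_scheme \<Rightarrow> 'b set \<Rightarrow> ('g \<Rightarrow> 'b \<Rightarrow> 'b) \<Rightarrow> 'b \<Rightarrow> 'b \<Rightarrow> real" where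
  "burnside_matrix G E \<phi> x y =
     1 / real (card (stabilizer G \<phi> x)) *
     (\<Sum>s\<in>stabilizer G \<phi> x \<inter> stabilizer G \<phi> y. 1 / real (card (invariants E \<phi> s)))"

definition cube_burnside_matrix :: "nat \<Rightarrow> (nat \<Rightarrow> nat) \<Rightarrow> (nat \<Rightarrow> nat) \<Rightarrow> real" where
  "cube_burnside_matrix n = burnside_matrix (sym_group n) (cube n) (coord_action n)"

definition stochastic_matrix :: "'s set \<Rightarrow> ('s \<Rightarrow> 's \<Rightarrow> real) \<Rightarrow> bool" where
  "stochastic_matrix E K \<longleftrightarrow>
     (\<forall>x\<in>E. (\<forall>y\<in>E. 0 \<le> K x y) \<and> (K x has_sum 1) E)"

(* Time-homogeneous Markov chain on a countable state space. The initial law, i.e. the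
   distribution of X 0, is unconstrained. Conditioning is on the whole history up to time t;
   a path x that leaves E has a history of probability 0. *)
definition markov_chain ::
  "'w measure \<Rightarrow> 's set \<Rightarrow> ('s \<Rightarrow> 's \<Rightarrow> real) \<Rightarrow> (nat \<Rightarrow> 'w \<Rightarrow> 's) \<Rightarrow> bool" where
  "markov_chain M E K X \<longleftrightarrow>
     prob_space M \<and> countable E \<and> stochastic_matrix E K \<and>
     (\<forall>t. X t \<in> M \<rightarrow>\<^sub>M count_space E) \<and>
     (\<forall>t x. \<forall>y\<in>E. \<P>(\<omega> in M. \<forall>i\<le>t. X i \<omega> = x i) \<noteq> 0 \<longrightarrow>
        \<P>(\<omega> in M. X (Suc t) \<omega> = y \<bar> \<forall>i\<le>t. X i \<omega> = x i) = K (x t) y)"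

lemma coord_action_group_action: "group_action (sym_group n) (cube n) (coord_action n)"
proof -
  have closed: "x \<circ> s \<in> cube n" if "x \<in> cube n" "s permutes {1..n}" for x s
  proof -
    have "x i \<in> {0, 1}" if "i \<in> {1..n}" for i
      using that \<open>x \<in> cube n\<close> unfolding cube_def by (rule PiE_mem[rotated])
    moreover have "x i = undefined" if "i \<notin> {1..n}" for i
      using that \<open>x \<in> cube n\<close> unfolding cube_def by (rule PiE_arb[rotated])
    ultimately show ?thesis
      using permutes_in_image[OF \<open>s permutes {1..n}\<close>] unfolding cube_def
      by (intro PiE_I) (simp_all only: o_apply not_False_eq_True)
  qed
  have bij: "coord_action n s \<in> Bij (cube n)" if s: "s permutes {1..n}" for s
  proof -
    have "bij_betw (\<lambda>x. x \<circ> inv' s) (cube n) (cube n)"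
      by (rule bij_betwI[where g = "\<lambda>x. x \<circ> s"])
        (auto simp: comp_assoc permutes_inv_o[OF s]
          intro: closed[OF _ s] closed[OF _ permutes_inv[OF s]])
    then show ?thesis
      by (simp add: Bij_def coord_action_def bij_betw_def inj_on_def)
  qed
  have "coord_action n (s \<circ> r) = compose (cube n) (coord_action n s) (coord_action n r)"
    if "s permutes {1..n}" "r permutes {1..n}" for s r
    using closed[OF _ permutes_inv[OF that(2)]]
    by (auto simp: coord_action_def compose_def restrict_def comp_assoc
        o_inv_distrib[OF permutes_bij[OF that(1)] permutes_bij[OF that(2)]])
  then show ?thesis
    using bij
    by (auto simp: group_action_def group_hom_def group_hom_axioms_def hom_def
        sym_group_is_group group_BijGroup sym_group_carrier sym_group_mult)
      (simp_all add: BijGroup_def)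
qed

(* The matrix is that of the two-step procedure: a uniform s in the stabilizer of x, then a
   uniform fixed point of s. *)
lemma burnside_matrix_two_step:
  assumes "finite (stabilizer G \<phi> x)" "stabilizer G \<phi> x \<noteq> {}" "finite E" "x \<in> E" "y \<in> E"
  shows "burnside_matrix G E \<phi> x y =
    pmf (pmf_of_set (stabilizer G \<phi> x) \<bind> (\<lambda>s. pmf_of_set (invariants E \<phi> s))) y"
proof -
  have inv: "pmf (pmf_of_set (invariants E \<phi> s)) y =
      (if s \<in> stabilizer G \<phi> y then 1 / real (card (invariants E \<phi> s)) else 0)"
    if "s \<in> stabilizer G \<phi> x" for s
  proof -
    have "x \<in> invariants E \<phi> s" "finite (invariants E \<phi> s)"
      using that assms by (auto simp: stabilizer_def invariants_def)
    moreover have "y \<in> invariants E \<phi> s \<longleftrightarrow> s \<in> stabilizer G \<phi> y"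
      using that assms by (auto simp: stabilizer_def invariants_def)
    ultimately show ?thesis
      by (subst pmf_of_set) (auto simp: indicator_def)
  qed
  have "(\<Sum>s\<in>stabilizer G \<phi> x. pmf (pmf_of_set (invariants E \<phi> s)) y) =
      (\<Sum>s\<in>stabilizer G \<phi> x \<inter> stabilizer G \<phi> y. 1 / real (card (invariants E \<phi> s)))"
    using assms(1) by (simp add: inv sum.inter_restrict)
  then show ?thesis
    using assms by (simp add: burnside_matrix_def pmf_bind integral_pmf_of_set)
qed

end

theory Submission
  imports Defs
begin

text \<open>
  The proof is by strong lumpability: it suffices that the entries of \<open>K\<^sub>n\<close> over a fibre of the
  restriction map add up to an entry of \<open>K\<^sub>m\<close>. Coordinates are removed one at a time. A permutation
  of \<open>A \<union> {a}\<close> is uniquely \<open>(a b) \<circ> p\<close> with \<open>p\<close> a permutation of \<open>A\<close>; it has as many fixed points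
  as \<open>p\<close> on binary tuples if \<open>b \<noteq> a\<close>, and twice as many if \<open>b = a\<close>. It stabilizes a colouring iff
  \<open>p\<close> does and \<open>a\<close>, \<open>b\<close> have the same colour. Hence passing from \<open>A\<close> to \<open>A \<union> {a}\<close> multiplies
  \<open>|G\<^sub>x|\<close> by \<open>1 + k\<close> and \<open>\<Sum>1 / |\<XX>\<^sub>s|\<close> by \<open>1/2 + k\<^sub>v\<close>, where \<open>k\<close> is the number of \<open>j \<in> A\<close> with
  \<open>x\<^sub>j = x\<^sub>a\<close>, and \<open>k\<^sub>v\<close> the number of those with \<open>y\<^sub>j = v = y\<^sub>a\<close>. Summing over \<open>v\<close> makes the two
  factors cancel.
\<close>

hide_const (open) Finite_Cartesian_Product.transpose

section \<open>Permutations stabilizing a colouring\<close>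

text \<open>Colours have an arbitrary type so that the pair colouring
  \<open>\<lambda>i. (x i, y i)\<close> is allowed; its stabilizer is the intersection of those of
  \<open>x\<close> and \<open>y\<close>.\<close>

definition coloring_stabilizer :: "'a set \<Rightarrow> ('a \<Rightarrow> 'c) \<Rightarrow> ('a \<Rightarrow> 'a) set" where
  "coloring_stabilizer A c = {s. s permutes A \<and> (\<forall>i\<in>A. c (s i) = c i)}"

definition fixed_colorings :: "'d set \<Rightarrow> 'a set \<Rightarrow> ('a \<Rightarrow> 'a) \<Rightarrow> ('a \<Rightarrow> 'd) set" where
  "fixed_colorings D A s = {y \<in> A \<rightarrow>\<^sub>E D. \<forall>i\<in>A. y (s i) = y i}"

text \<open>For the pair colouring of \<open>x\<close> and \<open>y\<close> this is the sum in the
  Burnside matrix, over the permutations fixing both.\<close>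

definition fix_weight :: "'d set \<Rightarrow> 'a set \<Rightarrow> ('a \<Rightarrow> 'c) \<Rightarrow> real" where
  "fix_weight D A c = (\<Sum>s\<in>coloring_stabilizer A c. 1 / card (fixed_colorings D A s))"

text \<open>The Burnside kernel for any alphabet \<open>D\<close> and any coordinate set
  \<open>A\<close>. Unlike \<open>{1..n}\<close>, such sets allow coordinates to be removed in any
  order without renumbering.\<close>

definition coloring_kernel :: "'d set \<Rightarrow> 'a set \<Rightarrow> ('a \<Rightarrow> 'c) \<Rightarrow> ('a \<Rightarrow> 'd) \<Rightarrow> real" where
  "coloring_kernel D A x y =
     fix_weight D A (\<lambda>i. (x i, y i)) / card (coloring_stabilizer A x)"

lemma coloring_stabilizer_cong:
  assumes "\<And>i. i \<in> A \<Longrightarrow> c i = d i"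
  shows "coloring_stabilizer A c = coloring_stabilizer A d"
  using assms by (auto simp: coloring_stabilizer_def permutes_in_image)

lemma coloring_kernel_cong:
  assumes "\<And>i. i \<in> A \<Longrightarrow> x i = x' i" "\<And>i. i \<in> A \<Longrightarrow> y i = y' i"
  shows "coloring_kernel D A x y = coloring_kernel D A x' y'"
proof -
  have "coloring_stabilizer A (\<lambda>i. (x i, y i)) = coloring_stabilizer A (\<lambda>i. (x' i, y' i))"
    by (rule coloring_stabilizer_cong) (simp add: assms)
  then show ?thesis
    using coloring_stabilizer_cong[of A x x'] assms
    by (simp add: coloring_kernel_def fix_weight_def)
qed

text \<open>Since \<open>p\<close> fixes \<open>a\<close>, the composite sends \<open>a\<close> to
  \<open>b\<close>, which forces equal colours there. Once they are equal the transposition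
  preserves all colours and drops out of the condition on \<open>A\<close>.\<close>

lemma transpose_comp_stabilizes_iff:
  assumes p: "p permutes A" and a: "a \<notin> A" and b: "b \<in> insert a A"
  shows "(\<forall>i\<in>insert a A. c ((transpose a b \<circ> p) i) = c i) \<longleftrightarrow>
    c b = c a \<and> (\<forall>i\<in>A. c (p i) = c i)"
proof -
  have pa: "p a = a"
    using p a by (rule permutes_not_in)
  have "c (transpose a b j) = c j" if "c b = c a" for j
    using that by (simp add: Transposition.transpose_def)
  then show ?thesis
    using pa by auto
qed

text \<open>From the composite, \<open>b\<close> is recovered as the image of \<open>a\<close>, and
  then \<open>p\<close> by undoing the transposition. Every permutation of \<open>insert a A\<close>
  splits in this way, and the stabilizing condition splits along with it.\<close>

lemma coloring_stabilizer_insert: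
  assumes a: "a \<notin> A"
  shows "bij_betw (\<lambda>(b, p). transpose a b \<circ> p)
    ({b\<in>insert a A. c b = c a} \<times> coloring_stabilizer A c) (coloring_stabilizer (insert a A) c)"
proof -
  let ?h = "\<lambda>(b, p). transpose a b \<circ> p"
  have "inj_on ?h (insert a A \<times> {p. p permutes A})"
  proof (rule inj_onI, clarify)
    fix b p b' p'
    assume p: "p permutes A" "p' permutes A"
      and eq: "transpose a b \<circ> p = transpose a b' \<circ> p'"
    have "(transpose a b \<circ> p) a = b" "(transpose a b' \<circ> p') a = b'"
      using p a by (simp_all add: permutes_not_in)
    with eq have b: "b = b'"
      by simp
    have "transpose a b \<circ> (transpose a b \<circ> p) = transpose a b \<circ> (transpose a b \<circ> p')"
      using eq b by simp
    then show "b = b' \<and> p = p'"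
      using b by (simp flip: comp_assoc)
  qed
  then have "inj_on ?h ({b\<in>insert a A. c b = c a} \<times> coloring_stabilizer A c)"
    by (rule inj_on_subset) (auto simp: coloring_stabilizer_def)
  moreover have "?h ` ({b\<in>insert a A. c b = c a} \<times> coloring_stabilizer A c) =
      coloring_stabilizer (insert a A) c"
  proof (intro equalityI subsetI)
    fix s assume "s \<in> ?h ` ({b\<in>insert a A. c b = c a} \<times> coloring_stabilizer A c)"
    then obtain b p where bp: "s = transpose a b \<circ> p" "b \<in> insert a A" "c b = c a"
      "p permutes A" "\<forall>i\<in>A. c (p i) = c i"
      by (auto simp: coloring_stabilizer_def)
    have "transpose a b permutes insert a A"
      using bp(2) by (intro permutes_swap_id) auto
    moreover have "p permutes insert a A"
      using bp(4) by (rule permutes_subset) auto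
    ultimately have "s permutes insert a A"
      unfolding bp(1) by (intro permutes_compose)
    then show "s \<in> coloring_stabilizer (insert a A) c"
      using transpose_comp_stabilizes_iff[OF bp(4) a bp(2), of c] bp
      by (simp add: coloring_stabilizer_def)
  next
    fix s assume s: "s \<in> coloring_stabilizer (insert a A) c"
    then have "s \<in> {s. s permutes insert a A}"
      by (simp add: coloring_stabilizer_def)
    then obtain b p where bp: "s = transpose a b \<circ> p" "b \<in> insert a A" "p permutes A"
      unfolding permutes_insert by auto
    then have "(b, p) \<in> {b\<in>insert a A. c b = c a} \<times> coloring_stabilizer A c"
      using s transpose_comp_stabilizes_iff[OF bp(3) a bp(2), of c]
      by (simp add: coloring_stabilizer_def)
    then show "s \<in> ?h ` ({b\<in>insert a A. c b = c a} \<times> coloring_stabilizer A c)"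
      using bp(1) by (intro image_eqI[of _ _ "(b, p)"]) auto
  qed
  ultimately show ?thesis
    by (simp add: bij_betw_def)
qed

lemma card_coloring_stabilizer_insert:
  assumes "finite A" "a \<notin> A"
  shows "card (coloring_stabilizer (insert a A) c) =
    (1 + card {j\<in>A. c j = c a}) * card (coloring_stabilizer A c)"
proof -
  have "{b\<in>insert a A. c b = c a} = insert a {j\<in>A. c j = c a}"
    by auto
  then show ?thesis
    using bij_betw_same_card[OF coloring_stabilizer_insert[OF assms(2), of c]] assms
    by (simp add: card_cartesian_product)
qed

text \<open>The point \<open>a\<close> is a cycle of its own, so its colour is a free choice from
  \<open>D\<close>.\<close>

lemma card_fixed_colorings_insert:
  assumes p: "p permutes A" and a: "a \<notin> A"
  shows "card (fixed_colorings D (insert a A) p) = card D * card (fixed_colorings D A p)"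
proof -
  have pa: "p a = a"
    using p a by (rule permutes_not_in)
  have pA: "p i \<in> A" if "i \<in> A" for i
    using that p by (simp add: permutes_in_image)
  have "bij_betw (\<lambda>(v, y). y(a := v)) (D \<times> fixed_colorings D A p)
      (fixed_colorings D (insert a A) p)"
  proof (rule bij_betwI[where g = "\<lambda>y. (y a, y(a := undefined))"])
    show "(\<lambda>(v, y). y(a := v)) \<in> D \<times> fixed_colorings D A p \<rightarrow> fixed_colorings D (insert a A) p"
      using a pa pA by (auto simp: fixed_colorings_def PiE_iff extensional_def)
    show "(\<lambda>y. (y a, y(a := undefined))) \<in>
        fixed_colorings D (insert a A) p \<rightarrow> D \<times> fixed_colorings D A p"
      using a pa pA by (auto simp: fixed_colorings_def PiE_iff extensional_def)
  qed (use a in \<open>auto simp: fixed_colorings_def PiE_iff extensional_def\<close>)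
  then show ?thesis
    using bij_betw_same_card by (fastforce simp: card_cartesian_product)
qed

text \<open>The composite inserts \<open>a\<close> into the cycle of \<open>b\<close> under
  \<open>p\<close>, so the colour of \<open>a\<close> is forced to be that of
  \<open>b\<close>.\<close>

lemma card_fixed_colorings_transpose:
  assumes p: "p permutes A" and a: "a \<notin> A" and b: "b \<in> A"
  shows "card (fixed_colorings D (insert a A) (transpose a b \<circ> p)) = card (fixed_colorings D A p)"
proof -
  have pA: "p i \<in> A" if "i \<in> A" for i
    using that p by (simp add: permutes_in_image)
  have iff: "y \<in> fixed_colorings D (insert a A) (transpose a b \<circ> p) \<longleftrightarrow>
      y \<in> insert a A \<rightarrow>\<^sub>E D \<and> y b = y a \<and> (\<forall>i\<in>A. y (p i) = y i)" for y
    unfolding fixed_colorings_def mem_Collect_eq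
    using transpose_comp_stabilizes_iff[OF p a, of b y] b by blast
  have "bij_betw (\<lambda>y. y(a := y b)) (fixed_colorings D A p)
      (fixed_colorings D (insert a A) (transpose a b \<circ> p))"
  proof (rule bij_betwI[where g = "\<lambda>y. y(a := undefined)"])
    show "(\<lambda>y. y(a := y b)) \<in>
        fixed_colorings D A p \<rightarrow> fixed_colorings D (insert a A) (transpose a b \<circ> p)"
      by (intro funcsetI, simp only: iff)
        (use a b pA in \<open>auto simp: fixed_colorings_def PiE_iff extensional_def\<close>)
    show "(\<lambda>y. y(a := undefined)) \<in>
        fixed_colorings D (insert a A) (transpose a b \<circ> p) \<rightarrow> fixed_colorings D A p"
      by (intro funcsetI, simp only: iff)
        (use a b pA in \<open>auto simp: fixed_colorings_def PiE_iff extensional_def\<close>)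
    show "(\<lambda>y. y(a := undefined)) ((\<lambda>y. y(a := y b)) y) = y" if "y \<in> fixed_colorings D A p" for y
      using that a by (auto simp: fixed_colorings_def PiE_iff extensional_def)
    show "(\<lambda>y. y(a := y b)) ((\<lambda>y. y(a := undefined)) y) = y"
      if "y \<in> fixed_colorings D (insert a A) (transpose a b \<circ> p)" for y
      using that a b unfolding iff by auto
  qed
  then show ?thesis
    by (simp add: bij_betw_same_card)
qed

text \<open>The choice \<open>b = a\<close> gives the summand \<open>1 / card D\<close>, from the
  free colour of a new fixed point. Every other admissible \<open>b\<close> leaves the fixed
  colourings equinumerous and contributes 1.\<close>

lemma fix_weight_insert:
  assumes A: "finite A" "a \<notin> A"
  shows "fix_weight D (insert a A) c =
    (1 / card D + card {j\<in>A. c j = c a}) * fix_weight D A c"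
proof -
  let ?F = "\<lambda>p. 1 / real (card (fixed_colorings D A p))"
  let ?F' = "\<lambda>p. 1 / real (card (fixed_colorings D (insert a A) p))"
  let ?G = "coloring_stabilizer A c"
  have perm: "p permutes A" if "p \<in> ?G" for p
    using that by (simp add: coloring_stabilizer_def)
  have split: "{b\<in>insert a A. c b = c a} = insert a {j\<in>A. c j = c a}"
    by auto
  have "fix_weight D (insert a A) c =
      (\<Sum>(b, p)\<in>{b\<in>insert a A. c b = c a} \<times> ?G. ?F' (transpose a b \<circ> p))"
    unfolding fix_weight_def
    by (subst sum.reindex_bij_betw[OF coloring_stabilizer_insert[OF A(2)], symmetric])
      (simp add: case_prod_unfold)
  also have "\<dots> = (\<Sum>b\<in>{b\<in>insert a A. c b = c a}. \<Sum>p\<in>?G. ?F' (transpose a b \<circ> p))"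
    by (rule sum.cartesian_product[symmetric])
  also have "\<dots> = (\<Sum>p\<in>?G. ?F' p) + (\<Sum>b\<in>{j\<in>A. c j = c a}. \<Sum>p\<in>?G. ?F' (transpose a b \<circ> p))"
    unfolding split using A by simp
  also have "(\<Sum>p\<in>?G. ?F' p) = 1 / card D * fix_weight D A c"
    unfolding fix_weight_def sum_distrib_left
    by (rule sum.cong) (simp_all add: card_fixed_colorings_insert perm A)
  also have "(\<Sum>b\<in>{j\<in>A. c j = c a}. \<Sum>p\<in>?G. ?F' (transpose a b \<circ> p)) =
      (\<Sum>b\<in>{j\<in>A. c j = c a}. \<Sum>p\<in>?G. ?F p)"
    by (intro sum.cong) (simp_all add: card_fixed_colorings_transpose perm A)
  finally show ?thesis
    by (simp add: fix_weight_def algebra_simps)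
qed

section \<open>Marginals and relabelling of the kernel\<close>

lemma sum_coloring_kernel_insert:
  assumes A: "finite A" "a \<notin> A" and D: "finite D" "D \<noteq> {}" and y: "y \<in> A \<rightarrow> D"
  shows "(\<Sum>v\<in>D. coloring_kernel D (insert a A) x (y(a := v))) = coloring_kernel D A x y"
proof -
  let ?W = "fix_weight D A (\<lambda>i. (x i, y i))"
  let ?k = "card {j\<in>A. x j = x a}"
  have weight: "fix_weight D (insert a A) (\<lambda>i. (x i, (y(a := v)) i)) =
      (1 / card D + card {j\<in>A. x j = x a \<and> y j = v}) * ?W" for v
  proof -
    have "coloring_stabilizer A (\<lambda>i. (x i, (y(a := v)) i)) = coloring_stabilizer A (\<lambda>i. (x i, y i))"
      using A by (intro coloring_stabilizer_cong) auto
    moreover have "{j\<in>A. (x j, (y(a := v)) j) = (x a, (y(a := v)) a)} =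
        {j\<in>A. x j = x a \<and> y j = v}"
      using A by auto
    ultimately show ?thesis
      using A by (simp add: fix_weight_insert) (simp add: fix_weight_def)
  qed
  \<comment> \<open>As \<open>y\<close> maps \<open>A\<close> into \<open>D\<close>, its values
    split the \<open>x\<close>-colour class of \<open>a\<close> into disjoint pieces.\<close>
  have "?k = (\<Sum>v\<in>D. card {j\<in>A. x j = x a \<and> y j = v})"
  proof -
    have "{j\<in>A. x j = x a} = (\<Union>v\<in>D. {j\<in>A. x j = x a \<and> y j = v})"
      using y by auto
    then show ?thesis
      using A D by (simp add: card_UN_disjoint disjoint_iff)
  qed
  then have "(\<Sum>v\<in>D. 1 / real (card D) + card {j\<in>A. x j = x a \<and> y j = v}) = 1 + ?k"
    using D by (simp add: sum.distrib)
  then have "(\<Sum>v\<in>D. fix_weight D (insert a A) (\<lambda>i. (x i, (y(a := v)) i))) = (1 + ?k) * ?W"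
    unfolding weight by (simp flip: sum_distrib_right)
  moreover have "real (card (coloring_stabilizer (insert a A) x)) =
      (1 + ?k) * card (coloring_stabilizer A x)"
    by (simp only: card_coloring_stabilizer_insert[OF A] of_nat_mult)
  ultimately show ?thesis
    unfolding coloring_kernel_def
    by (simp only: of_nat_mult nonzero_mult_divide_mult_cancel_left of_nat_eq_0_iff
        flip: sum_divide_distrib)
qed

text \<open>\<open>override_on y u C\<close> follows \<open>u\<close> on \<open>C\<close> and
  \<open>y\<close> elsewhere, so the sum runs over all extensions of \<open>y\<close> from
  \<open>A\<close> to \<open>A \<union> C\<close>. Induction on \<open>C\<close> sums out one
  coordinate at a time.\<close>

lemma sum_coloring_kernel_extensions:
  assumes "finite C" "finite A" "A \<inter> C = {}" "finite D" "D \<noteq> {}" "y \<in> A \<rightarrow> D"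
  shows "(\<Sum>u\<in>C \<rightarrow>\<^sub>E D. coloring_kernel D (A \<union> C) x (override_on y u C)) = coloring_kernel D A x y"
  using assms
proof (induction C rule: finite_induct)
  case empty
  then show ?case by simp
next
  case (insert c C)
  have upd: "override_on y (u(c := v)) (insert c C) = (override_on y u C)(c := v)" for u v
    by (auto simp: override_on_def)
  have "(\<Sum>u\<in>insert c C \<rightarrow>\<^sub>E D.
        coloring_kernel D (A \<union> insert c C) x (override_on y u (insert c C))) =
      (\<Sum>(v, u)\<in>D \<times> (C \<rightarrow>\<^sub>E D).
        coloring_kernel D (insert c (A \<union> C)) x ((override_on y u C)(c := v)))"
    unfolding PiE_insert_eq
    by (subst sum.reindex[OF inj_combinator[OF insert.hyps(2)]])
      (simp add: upd case_prod_unfold)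
  also have "\<dots> = (\<Sum>u\<in>C \<rightarrow>\<^sub>E D. \<Sum>v\<in>D.
        coloring_kernel D (insert c (A \<union> C)) x ((override_on y u C)(c := v)))"
    by (subst sum.swap) (rule sum.cartesian_product[symmetric])
  \<comment> \<open>The newest coordinate \<open>c\<close> is summed out first, with
    \<open>u\<close> fixed; the induction hypothesis then handles \<open>C\<close>.\<close>
  also have "\<dots> = (\<Sum>u\<in>C \<rightarrow>\<^sub>E D. coloring_kernel D (A \<union> C) x (override_on y u C))"
    using insert.hyps insert.prems
    by (intro sum.cong refl sum_coloring_kernel_insert) (auto simp: override_on_def)
  also have "\<dots> = coloring_kernel D A x y"
    using insert by auto
  finally show ?case .
qed

text \<open>The recursions determine the kernel, so relabelling needs no conjugation of permutations.\<close>

lemma card_relabelled_color_class: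
  assumes "inj_on f (insert b B)"
  shows "card {j\<in>f ` B. c j = c (f b)} = card {i\<in>B. c (f i) = c (f b)}"
proof -
  have "{j\<in>f ` B. c j = c (f b)} = f ` {i\<in>B. c (f i) = c (f b)}"
    by auto
  then show ?thesis
    using assms by (simp add: card_image inj_on_def)
qed

lemma card_coloring_stabilizer_image:
  assumes "finite B" "inj_on f B"
  shows "card (coloring_stabilizer (f ` B) c) = card (coloring_stabilizer B (\<lambda>i. c (f i)))"
  using assms
proof (induction B rule: finite_induct)
  case empty
  then show ?case by (simp add: coloring_stabilizer_def)
next
  case (insert b B)
  then have "f b \<notin> f ` B" by auto
  then show ?case
    using insert by (simp add: card_coloring_stabilizer_insert card_relabelled_color_class)
qed

lemma fix_weight_image:
  assumes "finite B" "inj_on f B"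
  shows "fix_weight D (f ` B) c = fix_weight D B (\<lambda>i. c (f i))"
  using assms
proof (induction B rule: finite_induct)
  case empty
  then show ?case by (simp add: fix_weight_def coloring_stabilizer_def fixed_colorings_def)
next
  case (insert b B)
  then have "f b \<notin> f ` B" by auto
  then show ?case
    using insert by (simp add: fix_weight_insert card_relabelled_color_class del: prod.inject)
qed

lemma coloring_kernel_image:
  assumes "finite B" "inj_on f B"
  shows "coloring_kernel D (f ` B) x y = coloring_kernel D B (\<lambda>i. x (f i)) (\<lambda>i. y (f i))"
  using assms by (simp add: coloring_kernel_def fix_weight_image card_coloring_stabilizer_image)

section \<open>The Burnside process on the cube\<close>

text \<open>Invariance under a permutation and under its inverse agree, and outside
  \<open>{1..n}\<close> the permutation is the identity, so only the coordinates in
  \<open>{1..n}\<close> are tested.\<close>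

lemma coord_action_fixes_iff:
  assumes "s permutes {1..n}" "x \<in> cube n"
  shows "coord_action n s x = x \<longleftrightarrow> (\<forall>i\<in>{1..n}. x (s i) = x i)"
proof -
  have "x \<circ> inv' s = x \<longleftrightarrow> x \<circ> s = x"
    by (metis assms(1) comp_assoc comp_id permutes_inv_o)
  also have "\<dots> \<longleftrightarrow> (\<forall>i\<in>{1..n}. x (s i) = x i)"
    using assms(1) by (auto simp: fun_eq_iff permutes_def)
  finally show ?thesis
    using assms(2) by (simp add: coord_action_def)
qed

lemma stabilizer_coord_action:
  assumes "x \<in> cube n"
  shows "stabilizer (sym_group n) (coord_action n) x = coloring_stabilizer {1..n} x"
  using assms
  by (auto simp: stabilizer_def coloring_stabilizer_def sym_group_carrier coord_action_fixes_iff)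

lemma invariants_coord_action:
  assumes "s permutes {1..n}"
  shows "invariants (cube n) (coord_action n) s = fixed_colorings {0, 1} {1..n} s"
  using coord_action_fixes_iff[OF assms]
  unfolding invariants_def fixed_colorings_def cube_def[symmetric] by blast

lemma cube_burnside_matrix_eq:
  assumes "x \<in> cube n" "y \<in> cube n"
  shows "cube_burnside_matrix n x y = coloring_kernel {0, 1} {1..n} x y"
proof -
  have "coloring_stabilizer {1..n} x \<inter> coloring_stabilizer {1..n} y =
      coloring_stabilizer {1..n} (\<lambda>i. (x i, y i))"
    by (auto simp: coloring_stabilizer_def)
  moreover have "invariants (cube n) (coord_action n) s = fixed_colorings {0, 1} {1..n} s"
    if "s \<in> coloring_stabilizer {1..n} (\<lambda>i. (x i, y i))" for s
    using that by (intro invariants_coord_action) (simp add: coloring_stabilizer_def)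
  ultimately show ?thesis
    using assms
    by (simp add: cube_burnside_matrix_def burnside_matrix_def stabilizer_coord_action
        coloring_kernel_def fix_weight_def)
qed

lemma finite_cube: "finite (cube n)"
  by (simp add: cube_def finite_PiE)

text \<open>Composing with \<open>f\<close> identifies binary tuples on \<open>S\<close> with those
  on \<open>{1..m}\<close>. Surjectivity makes all of \<open>cube m\<close> the state space of the
  lumped chain.\<close>

lemma restrict_cube_surj:
  assumes S: "S \<subseteq> {1..n}" and f: "bij_betw f {1..m} S"
  shows "(\<lambda>z. compose {1..m} (restrict z S) f) ` cube n = cube m"
proof (intro equalityI subsetI)
  have fS: "f i \<in> S" if "i \<in> {1..m}" for i
    using that f bij_betwE by blast
  {
    fix w assume "w \<in> (\<lambda>z. compose {1..m} (restrict z S) f) ` cube n"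
    then show "w \<in> cube m"
      using fS S by (fastforce simp: cube_def compose_def PiE_iff)
  next
    fix w assume w: "w \<in> cube m"
    \<comment> \<open>A preimage: \<open>w\<close> is carried to \<open>S\<close> by the inverse of
      \<open>f\<close>, and the other coordinates get the arbitrary value 0.\<close>
    define z where "z = (\<lambda>j\<in>{1..n}. if j \<in> S then w (inv_into {1..m} f j) else 0)"
    have "w (inv_into {1..m} f j) \<in> {0, 1}" if "j \<in> S" for j
      using w bij_betw_apply[OF bij_betw_inv_into[OF f] that] unfolding cube_def by (rule PiE_mem)
    then have "z \<in> cube n"
      unfolding cube_def by (intro PiE_I) (auto simp: z_def)
    moreover have "compose {1..m} (restrict z S) f = w"
    proof (rule extensionalityI)
      show "w \<in> extensional {1..m}"
        using w by (simp add: cube_def PiE_iff)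
      show "compose {1..m} (restrict z S) f i = w i" if "i \<in> {1..m}" for i
        using that fS[OF that] S f
        by (auto simp: compose_def z_def bij_betw_inv_into_left subset_iff)
    qed (rule compose_extensional)
    ultimately show "w \<in> (\<lambda>z. compose {1..m} (restrict z S) f) ` cube n"
      by blast
  }
qed

text \<open>This is the strong lumpability condition: the probability of entering a fibre depends on
  \<open>x\<close> only through its image. A fibre consists of all extensions to
  \<open>{1..n}\<close> of one tuple on \<open>S\<close>, so the off-\<open>S\<close> coordinates
  can be summed out.\<close>

lemma sum_cube_burnside_matrix_fibre:
  assumes S: "S \<subseteq> {1..n}" and f: "bij_betw f {1..m} S"
    and x: "x \<in> cube n" and w: "w \<in> cube m"
  shows "(\<Sum>y\<in>{y\<in>cube n. compose {1..m} (restrict y S) f = w}. cube_burnside_matrix n x y) =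
    cube_burnside_matrix m (compose {1..m} (restrict x S) f) w"
proof -
  let ?\<phi> = "\<lambda>y. compose {1..m} (restrict y S) f"
  let ?C = "{1..n} - S"
  \<comment> \<open>The tuple \<open>w\<close> carried back to \<open>S\<close>: the common
    restriction of all points of the fibre.\<close>
  define y0 where "y0 = (\<lambda>j\<in>S. w (inv_into {1..m} f j))"
  have fS: "f i \<in> S" if "i \<in> {1..m}" for i
    using that f bij_betwE by blast
  have img: "f ` {1..m} = S" and inj: "inj_on f {1..m}"
    using f by (auto simp: bij_betw_def)
  have \<phi>: "?\<phi> y i = y (f i)" if "i \<in> {1..m}" for y :: "nat \<Rightarrow> nat" and i
    using that fS by (simp add: compose_def)
  have y0: "y0 (f i) = w i" if "i \<in> {1..m}" for i
    using that fS f by (simp add: y0_def bij_betw_inv_into_left)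
  have g: "inv_into {1..m} f j \<in> {1..m}" "f (inv_into {1..m} f j) = j" if "j \<in> S" for j
    using that unfolding img[symmetric] by (rule inv_into_into, rule f_inv_into_f)
  have w01: "w i \<in> {0, 1}" if "i \<in> {1..m}" for i
    using w that unfolding cube_def by (rule PiE_mem)
  have y0D: "y0 \<in> S \<rightarrow> {0, 1}"
    using g w01 by (auto simp: y0_def)
  \<comment> \<open>Off \<open>{1..m}\<close> both functions are \<open>undefined\<close>, so their
    equality is decided on the coordinates indexed by \<open>S\<close>.\<close>
  have fibre: "?\<phi> y = w \<longleftrightarrow> (\<forall>j\<in>S. y j = y0 j)" for y
  proof
    assume "?\<phi> y = w"
    then show "\<forall>j\<in>S. y j = y0 j"
      using \<phi> y0 unfolding img[symmetric] by auto
  next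
    assume y: "\<forall>j\<in>S. y j = y0 j"
    show "?\<phi> y = w"
    proof
      fix i
      show "?\<phi> y i = w i"
      proof (cases "i \<in> {1..m}")
        case True
        then show ?thesis using y fS y0 \<phi> by simp
      next
        case False
        then have "?\<phi> y i = undefined"
          by (rule extensional_arb[OF compose_extensional])
        also have "\<dots> = w i"
          using w False unfolding cube_def by (rule PiE_arb[symmetric])
        finally show ?thesis .
      qed
    qed
  qed
  have "bij_betw (\<lambda>u. override_on y0 u ?C) (?C \<rightarrow>\<^sub>E {0, 1}) {y\<in>cube n. ?\<phi> y = w}"
    unfolding fibre
  proof (rule bij_betwI[where g = "\<lambda>y. restrict y ?C"])
    show "(\<lambda>u. override_on y0 u ?C) \<in> (?C \<rightarrow>\<^sub>E {0, 1}) \<rightarrow> {y \<in> cube n. \<forall>j\<in>S. y j = y0 j}"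
    proof (intro funcsetI CollectI conjI)
      fix u :: "nat \<Rightarrow> nat" assume u: "u \<in> ?C \<rightarrow>\<^sub>E {0, 1}"
      show "override_on y0 u ?C \<in> cube n"
        unfolding cube_def
      proof (rule PiE_I)
        fix i assume "i \<in> {1..n}"
        then show "override_on y0 u ?C i \<in> {0, 1}"
          using PiE_mem[OF u, of i] funcset_mem[OF y0D, of i] by (auto simp: override_on_def)
      next
        fix i assume "i \<notin> {1..n}"
        then show "override_on y0 u ?C i = undefined"
          using S by (auto simp: override_on_def y0_def)
      qed
    qed (simp add: override_on_def)
    show "(\<lambda>y. restrict y ?C) \<in> {y \<in> cube n. \<forall>j\<in>S. y j = y0 j} \<rightarrow> (?C \<rightarrow>\<^sub>E {0, 1})"
      unfolding cube_def
      by (intro funcsetI restrict_PiE_iff[THEN iffD2] ballI)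
        (rule PiE_mem[of _ "{1..n}"], auto)
    show "restrict (override_on y0 u ?C) ?C = u" if "u \<in> ?C \<rightarrow>\<^sub>E {0, 1}" for u
      using that by (fastforce simp: fun_eq_iff override_on_def restrict_def PiE_iff extensional_def)
    show "override_on y0 (restrict y ?C) ?C = y" if "y \<in> {y \<in> cube n. \<forall>j\<in>S. y j = y0 j}" for y
      using that S
      by (fastforce simp: fun_eq_iff override_on_def y0_def cube_def PiE_iff extensional_def)
  qed
  then have "(\<Sum>y\<in>{y\<in>cube n. ?\<phi> y = w}. cube_burnside_matrix n x y) =
      (\<Sum>u\<in>?C \<rightarrow>\<^sub>E {0, 1}. cube_burnside_matrix n x (override_on y0 u ?C))"
    by (rule sum.reindex_bij_betw[symmetric])
  also have "\<dots> = (\<Sum>u\<in>?C \<rightarrow>\<^sub>E {0, 1}. coloring_kernel {0, 1} (S \<union> ?C) x (override_on y0 u ?C))"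
  proof (rule sum.cong[OF refl])
    fix u assume "u \<in> ?C \<rightarrow>\<^sub>E {0::nat, 1}"
    then have "override_on y0 u ?C \<in> cube n"
      using \<open>bij_betw _ _ {y\<in>cube n. ?\<phi> y = w}\<close> bij_betwE by blast
    moreover have "S \<union> ?C = {1..n}"
      using S by auto
    ultimately show "cube_burnside_matrix n x (override_on y0 u ?C) =
        coloring_kernel {0, 1} (S \<union> ?C) x (override_on y0 u ?C)"
      using x by (simp only: cube_burnside_matrix_eq)
  qed
  \<comment> \<open>The coordinates outside \<open>S\<close> are summed out here; the next step
    renumbers \<open>S\<close> by \<open>f\<close>.\<close>
  also have "\<dots> = coloring_kernel {0, 1} S x y0"
    using S y0D by (intro sum_coloring_kernel_extensions) (auto intro: finite_subset)
  also have "\<dots> = coloring_kernel {0, 1} {1..m} (\<lambda>i. x (f i)) (\<lambda>i. y0 (f i))"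
    using coloring_kernel_image[OF _ inj] img by auto
  also have "\<dots> = coloring_kernel {0, 1} {1..m} (?\<phi> x) w"
    by (rule coloring_kernel_cong) (simp_all only: \<phi> y0)
  also have "\<dots> = cube_burnside_matrix m (?\<phi> x) w"
  proof -
    have "?\<phi> x \<in> cube m"
      using restrict_cube_surj[OF S f] x by blast
    then show ?thesis
      using w by (simp add: cube_burnside_matrix_eq)
  qed
  finally show ?thesis .
qed

section \<open>Lumping finite Markov chains\<close>

text \<open>A history of the image chain is a finite disjoint union of histories of
  \<open>X\<close>. Each ends in a state over \<open>v t\<close>, from which the fibre of
  \<open>w\<close> is entered with probability \<open>K' (v t) w\<close>; this common factor
  survives the summation, whatever the initial law.\<close>

lemma markov_chain_lump:
  assumes mc: "markov_chain M E K X" and fin: "finite E" and surj: "\<phi> ` E = E'"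
    and lump: "\<And>x w. x \<in> E \<Longrightarrow> w \<in> E' \<Longrightarrow> (\<Sum>y\<in>{y\<in>E. \<phi> y = w}. K x y) = K' (\<phi> x) w"
  shows "markov_chain M E' K' (\<lambda>t \<omega>. \<phi> (X t \<omega>))"
proof -
  interpret prob_space M
    using mc by (simp add: markov_chain_def)
  have fin': "finite E'"
    using fin surj by auto
  have X[measurable]: "X t \<in> M \<rightarrow>\<^sub>M count_space E" for t
    using mc by (simp add: markov_chain_def)
  have XE: "X t \<omega> \<in> E" if "\<omega> \<in> space M" for t \<omega>
    using measurable_space[OF X that] by simp
  have meas: "(\<lambda>\<omega>. \<phi> (X t \<omega>)) \<in> M \<rightarrow>\<^sub>M count_space E'" for t
    by (rule measurable_compose[OF X]) (use surj in auto)
  have K0: "0 \<le> K x y" and K1: "(\<Sum>y\<in>E. K x y) = 1" if "x \<in> E" "y \<in> E" for x y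
    using mc that fin
    by (auto simp: markov_chain_def stochastic_matrix_def has_sum_finite_iff)
  have "stochastic_matrix E' K'"
    unfolding stochastic_matrix_def
  proof (intro ballI conjI)
    fix v assume "v \<in> E'"
    then obtain x where x: "x \<in> E" "v = \<phi> x"
      using surj by auto
    show "0 \<le> K' v w" if "w \<in> E'" for w
      unfolding x(2) lump[OF x(1) that, symmetric] using x K0 by (intro sum_nonneg) auto
    have "(\<Sum>w\<in>E'. K' v w) = (\<Sum>w\<in>E'. \<Sum>y\<in>{y\<in>E. \<phi> y = w}. K x y)"
      using lump x by simp
    \<comment> \<open>The fibres partition \<open>E\<close>, so a row sum of \<open>K'\<close> is a
      row sum of \<open>K\<close>.\<close>
    also have "\<dots> = (\<Sum>y\<in>E. K x y)"
      using fin fin' surj by (intro sum.group) auto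
    also have "\<dots> = 1"
      using K1 x by blast
    finally show "(K' v has_sum 1) E'"
      using fin' by (simp add: has_sum_finite_iff)
  qed
  moreover have "\<P>(\<omega> in M. \<phi> (X (Suc t) \<omega>) = w \<bar> \<forall>i\<le>t. \<phi> (X i \<omega>) = v i) = K' (v t) w"
    if w: "w \<in> E'" and pos: "\<P>(\<omega> in M. \<forall>i\<le>t. \<phi> (X i \<omega>) = v i) \<noteq> 0" for t v w
  proof -
    let ?H = "\<lambda>x. {\<omega> \<in> space M. \<forall>i\<le>t. X i \<omega> = x i}"
    \<comment> \<open>The paths in \<open>E\<close> lying over \<open>v\<close>. Being extensional
      on \<open>{..t}\<close>, they are finitely many, and distinct ones have disjoint
      histories.\<close>
    let ?P = "{x \<in> {..t} \<rightarrow>\<^sub>E E. \<forall>i\<le>t. \<phi> (x i) = v i}"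
    let ?F = "{y\<in>E. \<phi> y = w}"
    have sets[measurable]: "{\<omega> \<in> space M. X i \<omega> = y} \<in> sets M" for i y
    proof -
      have "{\<omega> \<in> space M. X i \<omega> = y} = X i -` ({y} \<inter> E) \<inter> space M"
        using XE by auto
      then show ?thesis
        using measurable_sets[OF X, of "{y} \<inter> E" i] by simp
    qed
    have H[measurable]: "?H x \<in> sets M" for x
      by measurable
    have finP: "finite ?P"
      using fin by (simp add: finite_PiE)
    have disj: "x = x'" if "x \<in> ?P" "x' \<in> ?P" "\<omega> \<in> ?H x" "\<omega> \<in> ?H x'" for x x' \<omega>
      using that by (intro PiE_ext[of x "{..t}" "\<lambda>_. E"]) auto
    have path: "restrict (\<lambda>i. X i \<omega>) {..t} \<in> ?P"
      if "\<omega> \<in> space M" "\<forall>i\<le>t. \<phi> (X i \<omega>) = v i" for \<omega>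
      using that XE by auto
    have "{\<omega> \<in> space M. \<forall>i\<le>t. \<phi> (X i \<omega>) = v i} = (\<Union>x\<in>?P. ?H x)"
    proof (intro equalityI subsetI)
      fix \<omega> assume \<omega>: "\<omega> \<in> {\<omega> \<in> space M. \<forall>i\<le>t. \<phi> (X i \<omega>) = v i}"
      show "\<omega> \<in> (\<Union>x\<in>?P. ?H x)"
        by (rule UN_I[OF path]) (use \<omega> in auto)
    qed auto
    then have hist: "\<P>(\<omega> in M. \<forall>i\<le>t. \<phi> (X i \<omega>) = v i) = (\<Sum>x\<in>?P. prob (?H x))"
      using finP H disj
      by (simp only:) (rule finite_measure_finite_Union, auto simp: disjoint_family_on_def)
    let ?J = "\<lambda>q. {\<omega> \<in> space M. X (Suc t) \<omega> = snd q \<and> (\<forall>i\<le>t. X i \<omega> = fst q i)}"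
    \<comment> \<open>The Markov property speaks only of histories of nonzero probability; for a
      null history both sides vanish by monotonicity.\<close>
    have step: "prob (?J (x, y)) = prob (?H x) * K (x t) y" if "x \<in> ?P" "y \<in> E" for x y
    proof (cases "prob (?H x) = 0")
      case True
      have "prob (?J (x, y)) \<le> prob (?H x)"
        by (intro finite_measure_mono H) auto
      then show ?thesis
        using True by (simp add: measure_le_0_iff)
    next
      case False
      then have "\<P>(\<omega> in M. X (Suc t) \<omega> = y \<bar> \<forall>i\<le>t. X i \<omega> = x i) = K (x t) y"
        using mc that(2) by (auto simp: markov_chain_def)
      then show ?thesis
        using False by (simp add: cond_prob_def field_simps)
    qed
    have "{\<omega> \<in> space M. \<phi> (X (Suc t) \<omega>) = w \<and> (\<forall>i\<le>t. \<phi> (X i \<omega>) = v i)} =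
        (\<Union>q\<in>?P \<times> ?F. ?J q)"
    proof (intro equalityI subsetI)
      fix \<omega> assume \<omega>: "\<omega> \<in> {\<omega> \<in> space M. \<phi> (X (Suc t) \<omega>) = w \<and> (\<forall>i\<le>t. \<phi> (X i \<omega>) = v i)}"
      show "\<omega> \<in> (\<Union>q\<in>?P \<times> ?F. ?J q)"
        by (rule UN_I[OF SigmaI[OF path, of _ "X (Suc t) \<omega>"]]) (use \<omega> XE in auto)
    qed auto
    moreover have "?J q \<in> sets M" for q
      by measurable
    moreover have "disjoint_family_on ?J (?P \<times> ?F)"
      unfolding disjoint_family_on_def
    proof (intro ballI impI equals0I)
      fix q q' \<omega>
      assume q: "q \<in> ?P \<times> ?F" "q' \<in> ?P \<times> ?F" "q \<noteq> q'" and \<omega>: "\<omega> \<in> ?J q \<inter> ?J q'"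
      have "fst q = fst q'"
        by (rule disj[of _ _ \<omega>]) (use q \<omega> in \<open>auto simp: mem_Times_iff\<close>)
      moreover have "snd q = snd q'"
        using \<omega> by auto
      ultimately show False
        using q(3) by (simp add: prod_eq_iff)
    qed
    ultimately have "\<P>(\<omega> in M. \<phi> (X (Suc t) \<omega>) = w \<and> (\<forall>i\<le>t. \<phi> (X i \<omega>) = v i)) =
        (\<Sum>q\<in>?P \<times> ?F. prob (?J q))"
      using finP fin by (simp only:) (rule finite_measure_finite_Union, auto)
    also have "\<dots> = (\<Sum>x\<in>?P. \<Sum>y\<in>?F. prob (?J (x, y)))"
      by (simp add: sum.cartesian_product case_prod_unfold)
    \<comment> \<open>Lumpability enters here: the inner sum depends on the path only through the
      image of its endpoint, which is \<open>v t\<close> for every path in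
      \<open>?P\<close>.\<close>
    also have "\<dots> = (\<Sum>x\<in>?P. prob (?H x) * K' (v t) w)"
    proof (rule sum.cong[OF refl])
      fix x assume x: "x \<in> ?P"
      then have "x t \<in> E" "\<phi> (x t) = v t"
        by auto
      then have "(\<Sum>y\<in>?F. K (x t) y) = K' (v t) w"
        using lump w by metis
      then show "(\<Sum>y\<in>?F. prob (?J (x, y))) = prob (?H x) * K' (v t) w"
        using step[OF x] by (simp flip: sum_distrib_left)
    qed
    also have "\<dots> = \<P>(\<omega> in M. \<forall>i\<le>t. \<phi> (X i \<omega>) = v i) * K' (v t) w"
      by (simp only: hist sum_distrib_right)
    finally show ?thesis
      using pos by (simp add: cond_prob_def)
  qed
  ultimately show ?thesis
    using fin' meas by (simp add: markov_chain_def prob_space_axioms countable_finite)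
qed

text \<open>Any numbering \<open>f\<close> of \<open>S\<close> may serve as the identification of
  tuples on \<open>S\<close> with \<open>cube m\<close>. Surjectivity and the fibre sums supply the
  hypotheses of the lumping lemma.\<close>

theorem proposition3p3:
  fixes m n :: nat and S :: "nat set" and f :: "nat \<Rightarrow> nat"
    and M :: "'w measure" and X :: "nat \<Rightarrow> 'w \<Rightarrow> (nat \<Rightarrow> nat)"
  assumes "1 \<le> m" and "m \<le> n"
    and "S \<subseteq> {1..n}" and "card S = m"
    and "bij_betw f {1..m} S"
    and "markov_chain M (cube n) (cube_burnside_matrix n) X"
  shows "markov_chain M (cube m) (cube_burnside_matrix m)
           (\<lambda>t \<omega>. compose {1..m} (restrict (X t \<omega>) S) f)"
  using assms(6) finite_cube restrict_cube_surj[OF assms(3,5)]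
    sum_cube_burnside_matrix_fibre[OF assms(3,5)]
  by (rule markov_chain_lump)

end
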